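(* If $G$ is an almost bipartite non-König-Egerváry graph, then $$\varrho_v(G)=n(G)+d(G)-\xi(G)-\beta(G)=2\alpha(G)+1-\xi(G)-\beta(G).$$
   Context: All graphs are finite, undirected, loopless, without multiple edges; $n(G)=|V(G)|$. $\alpha(G)$ is the maximum size of an independent set and $\mu(G)$ the maximum size of a matching. $G$ is a König-Egerváry graph if $\alpha(G)+\mu(G)=n(G)$. $G$ is almost bipartite if it has exactly one odd cycle. $\varrho_v(G)$ is the number of vertices $v\in V(G)$ such that $G-v$ is a König-Egerváry graph. $\mathrm{core}(G)$ is the intersection of all maximum independent sets of $G$ and $\xi(G)=|\mathrm{core}(G)|$. For $X\subseteq V(G)$, $N_G(X)=\{v: v \text{ has a neighbor in } X\}$ and $d(X)=|X|-|N_G(X)|$; the critical difference is $d(G)=\max\{d(I): I \text{ independent in } G\}$; an independent set $A$ (possibly empty) is a critical independent set if $d(A)=d(G)$. $\mathrm{diadem}(G)$ is the union of all critical independent sets of $G$ and $\beta(G)=|\mathrm{diadem}(G)|$. *)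

theory Defs
  imports Main
begin

text \<open>A graph is given by its vertex set \<open>V\<close> and its set \<open>E\<close> of edges, an edge being
  a two-element set of vertices.\<close>

definition simple_graph :: "'a set \<Rightarrow> 'a set set \<Rightarrow> bool" where
  "simple_graph V E \<longleftrightarrow> finite V \<and> (\<forall>e\<in>E. e \<subseteq> V \<and> card e = 2)"

definition independent :: "'a set \<Rightarrow> 'a set set \<Rightarrow> 'a set \<Rightarrow> bool" where
  "independent V E S \<longleftrightarrow> S \<subseteq> V \<and> (\<forall>u\<in>S. \<forall>v\<in>S. {u, v} \<notin> E)"

definition independence_number :: "'a set \<Rightarrow> 'a set set \<Rightarrow> nat" where
  "independence_number V E = Max {card S | S. independent V E S}"

definition max_independent :: "'a set \<Rightarrow> 'a set set \<Rightarrow> 'a set \<Rightarrow> bool" where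
  "max_independent V E S \<longleftrightarrow> independent V E S \<and> card S = independence_number V E"

definition matching :: "'a set set \<Rightarrow> 'a set set \<Rightarrow> bool" where
  "matching E M \<longleftrightarrow> M \<subseteq> E \<and> pairwise disjnt M"

definition matching_number :: "'a set set \<Rightarrow> nat" where
  "matching_number E = Max {card M | M. matching E M}"

definition konig_egervary :: "'a set \<Rightarrow> 'a set set \<Rightarrow> bool" where
  "konig_egervary V E \<longleftrightarrow> independence_number V E + matching_number E = card V"

text \<open>A cycle is a subgraph, and is identified with its edge set; thus rotations and reversals
  of a vertex sequence represent the same cycle.\<close>

definition cycle_edges :: "'a list \<Rightarrow> 'a set set" where
  "cycle_edges xs = {{xs ! i, xs ! (Suc i mod length xs)} | i. i < length xs}"

definition odd_cycle :: "'a set set \<Rightarrow> 'a set set \<Rightarrow> bool" where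
  "odd_cycle E C \<longleftrightarrow>
     C \<subseteq> E \<and> (\<exists>xs. distinct xs \<and> 3 \<le> length xs \<and> odd (length xs) \<and> C = cycle_edges xs)"

definition almost_bipartite :: "'a set set \<Rightarrow> bool" where
  "almost_bipartite E \<longleftrightarrow> (\<exists>!C. odd_cycle E C)"

definition delete_vertex_edges :: "'a set set \<Rightarrow> 'a \<Rightarrow> 'a set set" where
  "delete_vertex_edges E v = {e \<in> E. v \<notin> e}"

definition rho_v :: "'a set \<Rightarrow> 'a set set \<Rightarrow> nat" where
  "rho_v V E = card {v \<in> V. konig_egervary (V - {v}) (delete_vertex_edges E v)}"

definition core :: "'a set \<Rightarrow> 'a set set \<Rightarrow> 'a set" where
  "core V E = \<Inter> {S. max_independent V E S}"

definition xi :: "'a set \<Rightarrow> 'a set set \<Rightarrow> nat" where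
  "xi V E = card (core V E)"

definition neighbors :: "'a set \<Rightarrow> 'a set set \<Rightarrow> 'a set \<Rightarrow> 'a set" where
  "neighbors V E X = {v \<in> V. \<exists>u\<in>X. {u, v} \<in> E}"

definition difference :: "'a set \<Rightarrow> 'a set set \<Rightarrow> 'a set \<Rightarrow> int" where
  "difference V E X = int (card X) - int (card (neighbors V E X))"

definition critical_difference :: "'a set \<Rightarrow> 'a set set \<Rightarrow> int" where
  "critical_difference V E = Max {difference V E I | I. independent V E I}"

definition critical_independent :: "'a set \<Rightarrow> 'a set set \<Rightarrow> 'a set \<Rightarrow> bool" where
  "critical_independent V E A \<longleftrightarrow>
     independent V E A \<and> difference V E A = critical_difference V E"

definition diadem :: "'a set \<Rightarrow> 'a set set \<Rightarrow> 'a set" where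
  "diadem V E = \<Union> {A. critical_independent V E A}"

definition beta :: "'a set \<Rightarrow> 'a set set \<Rightarrow> nat" where
  "beta V E = card (diadem V E)"

end

theory Submission
  imports Defs
begin

text \<open>
  Let \<open>I\<close> be a critical independent set of the largest possible size, \<open>T\<close> its set of
  neighbours, and \<open>Z\<close> the remaining vertices. No edge joins \<open>I\<close> to \<open>I \<union> Z\<close>. Criticality of
  \<open>I\<close> is Hall's condition for matching \<open>T\<close> into \<open>I\<close>; fix such a matching \<open>m\<close>. Maximality
  of \<open>I\<close> says that every nonempty independent \<open>J \<subseteq> Z\<close> has more than \<open>|J|\<close> neighbours in \<open>Z\<close>
  (\<open>critical_split_exists\<close>). A nonempty bipartite graph cannot expand like this, since one
  side would have to be larger than the other and conversely. So if \<open>Z\<close> had no odd cycle it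
  would be empty, and then \<open>m\<close> shows that the graph is a Koenig-Egervary graph.

  Hence \<open>Z\<close> contains the unique odd cycle. Removing a vertex \<open>c\<close> of it from \<open>Z\<close> leaves a
  bipartite graph, and now expansion forces its two sides to have the same size \<open>k\<close>. Thus
  \<open>|Z| = 2k + 1\<close>, every \<open>z \<in> Z\<close> is avoided by an independent \<open>k\<close>-set of \<open>Z\<close> (one of the two
  sides), and Hall's theorem matches that side perfectly onto the rest of \<open>Z - {z}\<close>. It follows that
  \<open>\<alpha> = |I| + k\<close>, \<open>\<mu> = |T| + k\<close> and \<open>d = |I| - |T|\<close>, so that
  \<open>n = \<alpha> + \<mu> + 1\<close> and \<open>n + d = 2 \<alpha> + 1\<close>.

  Since \<open>n = \<alpha> + \<mu> + 1\<close>, the graph \<open>G - v\<close> is Koenig-Egervary exactly when deleting \<open>v\<close>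
  lowers neither \<open>\<alpha>\<close> nor \<open>\<mu>\<close>: some maximum independent set avoids \<open>v\<close> and some maximum matching misses \<open>v\<close>.
  All vertices of \<open>Z\<close> qualify, no vertex of \<open>T\<close> does. For \<open>I\<close>, call an independent
  \<open>K \<subseteq> I \<union> T\<close> of size \<open>|I|\<close> without neighbours in \<open>Z\<close> an exchange set; it can replace
  \<open>I\<close> in all the arguments above. So if \<open>v \<in> I - K\<close> for some exchange set \<open>K\<close>, then every maximum
  matching covers \<open>v\<close>. Conversely, if \<open>v \<in> I\<close> lies outside the core and every maximum matching covers \<open>v\<close>, then
  the failure of Hall's condition for rematching \<open>T\<close> without \<open>v\<close> yields an exchange set that
  avoids \<open>v\<close> (\<open>missed_or_exchange_avoiding\<close>). With \<open>P\<close> the set of vertices of \<open>I\<close> avoided by some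
  exchange set, this gives \<open>\<rho> = |Z| + |I| - \<xi> - |P|\<close>.

  Finally the diadem is the union of the exchange sets (\<open>diadem_eq\<close>). An exchange set contains
  exactly one of \<open>t\<close> and \<open>m t\<close> for each \<open>t \<in> T\<close>, so \<open>m\<close> is a bijection from the part of the
  diadem in \<open>T\<close> onto \<open>P\<close>, and \<open>\<beta> = |I| + |P|\<close>. Adding up,
  \<open>\<rho> + \<xi> + \<beta> = |Z| + 2 |I| = 2 \<alpha> + 1\<close>.
\<close>

section \<open>Hall's theorem\<close>

text \<open>The induction of Halmos and Vaughan. If some proper nonempty subfamily \<open>J\<close> has exactly
  \<open>|J|\<close> elements in its union, then \<open>J\<close> and the rest, with that union removed, both satisfy Hall's condition;
  otherwise there is slack everywhere, and any one index may be given any element of its set.\<close>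

lemma hall_distinct_representatives:
  assumes "finite I" and "\<And>i. i \<in> I \<Longrightarrow> finite (A i)"
    and "\<And>J. J \<subseteq> I \<Longrightarrow> card J \<le> card (\<Union>(A ` J))"
  shows "\<exists>f. inj_on f I \<and> (\<forall>i\<in>I. f i \<in> A i)"
  using assms
proof (induction "card I" arbitrary: I A rule: less_induct)
  case less
  note fin = less.prems(1) and finA = less.prems(2) and hall = less.prems(3)
  have finU: "finite (\<Union>(A ` J))" if "J \<subseteq> I" for J
    using that fin finA by (meson finite_UN_I finite_subset subsetD)
  consider "I = {}" | J where "J \<noteq> {}" "J \<subset> I" "card J = card (\<Union>(A ` J))"
    | "I \<noteq> {}" "\<And>J. J \<noteq> {} \<Longrightarrow> J \<subset> I \<Longrightarrow> card J < card (\<Union>(A ` J))"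
    using hall by (metis order_le_imp_less_or_eq psubset_imp_subset)
  then show ?case
  proof cases
    case 1
    then show ?thesis by simp
  next
    case (2 J)
    have finJ: "finite J" using 2 fin finite_subset by blast
    let ?U = "\<Union>(A ` J)"
    have "\<exists>f. inj_on f J \<and> (\<forall>i\<in>J. f i \<in> A i)"
    proof (rule less.hyps)
      show "card J < card I" using 2 fin psubset_card_mono by blast
    qed (use 2 finJ finA hall in auto)
    then obtain f where f: "inj_on f J" "\<And>i. i \<in> J \<Longrightarrow> f i \<in> A i" by blast
    have "\<exists>g. inj_on g (I - J) \<and> (\<forall>i\<in>I - J. g i \<in> A i - ?U)"
    proof (rule less.hyps)
      show "card (I - J) < card I"
        using 2 fin by (intro psubset_card_mono) auto
    next
      fix K assume K: "K \<subseteq> I - J"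
      then have finK: "finite K" using fin finite_subset by blast
      have "card (J \<union> K) \<le> card (\<Union>(A ` (J \<union> K)))" using K 2 by (intro hall) auto
      also have "\<Union>(A ` (J \<union> K)) = ?U \<union> \<Union>((\<lambda>i. A i - ?U) ` K)" by auto
      also have "card \<dots> = card ?U + card (\<Union>((\<lambda>i. A i - ?U) ` K))"
        using 2 K finU finK finA by (intro card_Un_disjoint) auto
      finally have "card (J \<union> K) \<le> card J + card (\<Union>((\<lambda>i. A i - ?U) ` K))" using 2 by simp
      moreover have "card (J \<union> K) = card J + card K"
        using finJ finK K by (intro card_Un_disjoint) auto
      ultimately show "card K \<le> card (\<Union>((\<lambda>i. A i - ?U) ` K))" by simp
    qed (use fin finA in auto)
    then obtain g where g: "inj_on g (I - J)" "\<And>i. i \<in> I - J \<Longrightarrow> g i \<in> A i - ?U" by blast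
    let ?h = "\<lambda>i. if i \<in> J then f i else g i"
    have "inj_on ?h I"
    proof (rule inj_onI)
      fix x y assume xy: "x \<in> I" "y \<in> I" "?h x = ?h y"
      have "x \<in> J \<longleftrightarrow> y \<in> J"
        using xy f(2)[of x] f(2)[of y] g(2)[of x] g(2)[of y] by (auto split: if_splits)
      then show "x = y" using xy f(1) g(1) by (auto simp: inj_on_def split: if_splits)
    qed
    moreover have "\<forall>i\<in>I. ?h i \<in> A i" using f g by auto
    ultimately show ?thesis by blast
  next
    case 3
    then obtain i where i: "i \<in> I" by blast
    have "card {i} \<le> card (\<Union>(A ` {i}))" using i by (intro hall) auto
    then obtain a where a: "a \<in> A i" by fastforce
    have "\<exists>g. inj_on g (I - {i}) \<and> (\<forall>j\<in>I - {i}. g j \<in> A j - {a})"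
    proof (rule less.hyps)
      show "card (I - {i}) < card I" using i fin by (intro psubset_card_mono) auto
    next
      fix K assume K: "K \<subseteq> I - {i}"
      have eq: "\<Union>((\<lambda>j. A j - {a}) ` K) = \<Union>(A ` K) - {a}" by auto
      show "card K \<le> card (\<Union>((\<lambda>j. A j - {a}) ` K))"
      proof (cases "K = {}")
        case False
        have "K \<subset> I" using K i by blast
        then have "card K < card (\<Union>(A ` K))" using 3 False by blast
        moreover have "card (\<Union>(A ` K)) - card {a} \<le> card (\<Union>(A ` K) - {a})"
          by (rule diff_card_le_card_Diff) simp
        ultimately show ?thesis unfolding eq by simp
      qed simp
    qed (use fin finA in auto)
    then obtain g where g: "inj_on g (I - {i})" "\<And>j. j \<in> I - {i} \<Longrightarrow> g j \<in> A j - {a}" by blast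
    have "inj_on (g(i := a)) I"
      using g by (auto simp: inj_on_def)
    moreover have "\<forall>j\<in>I. (g(i := a)) j \<in> A j" using g a by auto
    ultimately show ?thesis by blast
  qed
qed

section \<open>Graphs without odd cycles\<close>

text \<open>A shortest odd closed walk visits no vertex twice: a repetition would split it into two
  shorter closed walks, one of which is odd. Walks of length \<open>n\<close> are modelled as the \<open>n\<close>-th
  power of the adjacency relation.\<close>

lemma odd_closed_walk_imp_odd_cycle:
  assumes card2: "\<And>e. e \<in> E \<Longrightarrow> card e = 2"
    and "(x, x) \<in> {(u, v). {u, v} \<in> E} ^^ n" "odd n"
  shows "\<exists>C. odd_cycle E C"
proof -
  let ?R = "{(u, v). {u, v} \<in> E}"
  define P where "P n \<longleftrightarrow> odd n \<and> (\<exists>x. (x, x) \<in> ?R ^^ n)" for n :: nat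
  define N where "N = (LEAST n. P n)"
  have "P n" using assms unfolding P_def by blast
  then have PN: "P N" unfolding N_def by (rule LeastI)
  have least: "\<not> P k" if "k < N" for k using that not_less_Least unfolding N_def by blast
  obtain y where oddN: "odd N" and y: "(y, y) \<in> ?R ^^ N" using PN unfolding P_def by blast
  then obtain f where f: "f 0 = y" "f N = y" "\<And>i. i < N \<Longrightarrow> (f i, f (Suc i)) \<in> ?R"
    unfolding relpow_fun_conv by blast
  have walk: "(f i, f j) \<in> ?R ^^ (j - i)" if "i \<le> j" "j \<le> N" for i j
    unfolding relpow_fun_conv
    by (rule exI[of _ "\<lambda>l. f (i + l)"]) (use that f(3) in auto)
  have "inj_on f {..<N}"
  proof (rule linorder_inj_onI)
    fix i j assume ij: "i < j" "i \<in> {..<N}" "j \<in> {..<N}"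
    show "f i \<noteq> f j"
    proof
      assume eq: "f i = f j"
      have "(f i, f i) \<in> ?R ^^ (j - i)" using walk[of i j] ij eq by simp
      moreover have "(y, y) \<in> ?R ^^ (i + (N - j))"
        unfolding relpow_add using walk[of 0 i] walk[of j N] ij f eq by auto
      moreover have "odd (j - i) \<or> odd (i + (N - j))" using oddN ij by auto
      ultimately have "P (j - i) \<or> P (i + (N - j))" unfolding P_def by blast
      then show False using least ij by auto
    qed
  qed auto
  then have dist: "distinct (map f [0..<N])" by (simp add: distinct_map atLeast0LessThan)
  have "N \<noteq> 1"
  proof
    assume "N = 1"
    then have "{y, y} \<in> E" using f by force
    then show False using card2 by fastforce
  qed
  then have N3: "3 \<le> N" using oddN by presburger
  have "cycle_edges (map f [0..<N]) \<subseteq> E"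
  proof
    fix e assume "e \<in> cycle_edges (map f [0..<N])"
    then obtain i where i: "i < N" "e = {map f [0..<N] ! i, map f [0..<N] ! (Suc i mod N)}"
      unfolding cycle_edges_def by auto
    have "map f [0..<N] ! (Suc i mod N) = f (Suc i)"
      using i f N3 by (cases "Suc i = N") auto
    then show "e \<in> E" using i f(3) by auto
  qed
  then have "odd_cycle E (cycle_edges (map f [0..<N]))"
    unfolding odd_cycle_def using dist N3 oddN
    by (metis length_map length_upt minus_nat.diff_0)
  then show ?thesis by blast
qed

text \<open>Vertices are coloured by the parity of a walk from a fixed root of their component; two
  walks of different parity to the same vertex would close up to an odd walk.\<close>

lemma no_odd_cycle_imp_two_colouring:
  assumes card2: "\<And>e. e \<in> E \<Longrightarrow> card e = 2" and no: "\<And>C. \<not> odd_cycle E C"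
  shows "\<exists>X. \<forall>u v. {u, v} \<in> E \<longrightarrow> (u \<in> X \<longleftrightarrow> v \<notin> X)"
proof -
  let ?R = "{(u, v). {u, v} \<in> E}"
  have rev: "(v, u) \<in> ?R ^^ n" if "(u, v) \<in> ?R ^^ n" for u v n
    using that
  proof (induction n arbitrary: v)
    case (Suc n)
    then obtain w where "(u, w) \<in> ?R ^^ n" "(w, v) \<in> ?R" by auto
    then have "(w, u) \<in> ?R ^^ n" "(v, w) \<in> ?R" using Suc.IH by (auto simp: insert_commute)
    then show ?case by (meson relpow_Suc_I2)
  qed simp
  \<comment> \<open>The root: vertices of one component have the same set of possible choices, so \<open>SOME\<close>
    picks the same vertex for all of them.\<close>
  define r where "r v = (SOME u. (u, v) \<in> ?R\<^sup>*)" for v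
  have r: "(r v, v) \<in> ?R\<^sup>*" for v unfolding r_def by (rule someI[of _ v]) simp
  have req: "r u = r v" if "{u, v} \<in> E" for u v
  proof -
    have uv: "(u, v) \<in> ?R" and vu: "(v, u) \<in> ?R" using that by (auto simp: insert_commute)
    have "(\<lambda>w. (w, u) \<in> ?R\<^sup>*) = (\<lambda>w. (w, v) \<in> ?R\<^sup>*)"
      using rtrancl_into_rtrancl[OF _ uv] rtrancl_into_rtrancl[OF _ vu] by blast
    then show ?thesis unfolding r_def by simp
  qed
  define X where "X = {v. \<exists>n. even n \<and> (r v, v) \<in> ?R ^^ n}"
  have "u \<in> X \<longleftrightarrow> v \<notin> X" if uv: "{u, v} \<in> E" for u v
  proof -
    have *: False if "(r u, u) \<in> ?R ^^ a" "(r u, v) \<in> ?R ^^ b" "even (a + b)" for a b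
    proof -
      have "(u, v) \<in> ?R ^^ 1" using uv by simp
      then have "(r u, r u) \<in> ?R ^^ (a + 1 + b)"
        unfolding relpow_add using that(1) rev[OF that(2)] by blast
      moreover have "odd (a + 1 + b)" using that(3) by simp
      ultimately show False
        using odd_closed_walk_imp_odd_cycle[of E "r u", OF card2] no by blast
    qed
    obtain a where a: "(r u, u) \<in> ?R ^^ a" using rtrancl_imp_relpow[OF r[of u]] by blast
    obtain b where b: "(r u, v) \<in> ?R ^^ b"
      using rtrancl_imp_relpow[OF r[of v]] req[OF uv] by auto
    have "u \<in> X" if "v \<notin> X"
    proof -
      have "odd b" using that b req[OF uv] unfolding X_def by auto
      then have "even a" using *[OF a b] by auto
      then show ?thesis using a unfolding X_def by blast
    qed
    moreover have False if both: "u \<in> X" "v \<in> X"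
    proof -
      obtain a' b' where "even a'" "(r u, u) \<in> ?R ^^ a'" "even b'" "(r u, v) \<in> ?R ^^ b'"
        using both req[OF uv] unfolding X_def by auto
      then show False using *[of a' b'] by simp
    qed
    ultimately show ?thesis by blast
  qed
  then show ?thesis by blast
qed

section \<open>Independence, matching and critical difference\<close>

lemma neighbors_iff: "v \<in> neighbors V E X \<longleftrightarrow> v \<in> V \<and> (\<exists>u\<in>X. {u, v} \<in> E)"
  by (simp add: neighbors_def)

lemma card_le_independence_number:
  assumes "finite V" "independent V E S"
  shows "card S \<le> independence_number V E"
proof -
  have "{card S |S. independent V E S} \<subseteq> card ` Pow V" by (auto simp: independent_def)
  then have "finite {card S |S. independent V E S}" using assms(1) finite_subset by blast
  then show ?thesis unfolding independence_number_def using assms(2) by (intro Max_ge) auto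
qed

lemma independence_number_attained:
  assumes "finite V"
  shows "\<exists>S. max_independent V E S"
proof -
  have "{card S |S. independent V E S} \<subseteq> card ` Pow V" by (auto simp: independent_def)
  then have fin: "finite {card S |S. independent V E S}" using assms(1) finite_subset by blast
  have "independent V E {}" by (simp add: independent_def)
  then have "{card S |S. independent V E S} \<noteq> {}" by blast
  from Max_in[OF fin this] show ?thesis
    unfolding max_independent_def independence_number_def by auto
qed

lemma independence_number_eqI:
  assumes "finite V" "independent V E S" "card S = n"
    and "\<And>S. independent V E S \<Longrightarrow> card S \<le> n"
  shows "independence_number V E = n"
  using independence_number_attained[OF assms(1), of E] card_le_independence_number[OF assms(1,2)] assms(3,4)
  unfolding max_independent_def by (metis le_antisym)

lemma card_le_matching_number:
  assumes "finite E" "matching E M"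
  shows "card M \<le> matching_number E"
proof -
  have "{card M |M. matching E M} \<subseteq> card ` Pow E" by (auto simp: matching_def)
  then have "finite {card M |M. matching E M}" using assms(1) finite_subset by blast
  then show ?thesis unfolding matching_number_def using assms(2) by (intro Max_ge) auto
qed

lemma matching_number_attained:
  assumes "finite E"
  shows "\<exists>M. matching E M \<and> card M = matching_number E"
proof -
  have "{card M |M. matching E M} \<subseteq> card ` Pow E" by (auto simp: matching_def)
  then have fin: "finite {card M |M. matching E M}" using assms(1) finite_subset by blast
  have "matching E {}" by (simp add: matching_def)
  then have "{card M |M. matching E M} \<noteq> {}" by blast
  from Max_in[OF fin this] show ?thesis
    unfolding matching_number_def by auto
qed

lemma matching_number_eqI:
  assumes "finite E" "matching E M" "card M = n"
    and "\<And>M. matching E M \<Longrightarrow> card M \<le> n"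
  shows "matching_number E = n"
  using matching_number_attained[OF assms(1)] card_le_matching_number[OF assms(1,2)] assms(3,4)
  by (metis le_antisym)

lemma simple_graph_finite:
  assumes "simple_graph V E"
  shows "finite V" "finite E"
  using assms unfolding simple_graph_def by (auto intro: finite_subset[of E "Pow V"])

lemma independent_delete_vertex:
  "independent (V - {v}) (delete_vertex_edges E v) S \<longleftrightarrow> independent V E S \<and> v \<notin> S"
  by (auto simp: independent_def delete_vertex_edges_def)

lemma matching_delete_vertex:
  "matching (delete_vertex_edges E v) M \<longleftrightarrow> matching E M \<and> v \<notin> \<Union>M"
  by (auto simp: matching_def delete_vertex_edges_def)

text \<open>Deleting a vertex increases neither number. As \<open>\<alpha> + \<mu> = |V| - 1\<close> is already the number of
  vertices that remain, the Koenig-Egervary equation for \<open>G - v\<close> says that both numbers keep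
  their values.\<close>

lemma konig_egervary_delete_vertex_iff:
  assumes G: "simple_graph V E" and v: "v \<in> V"
    and defect: "independence_number V E + matching_number E + 1 = card V"
  shows "konig_egervary (V - {v}) (delete_vertex_edges E v) \<longleftrightarrow>
    v \<notin> core V E \<and> (\<exists>M. matching E M \<and> card M = matching_number E \<and> v \<notin> \<Union>M)"
proof -
  let ?V = "V - {v}" and ?E = "delete_vertex_edges E v"
  have fin: "finite V" "finite E" using simple_graph_finite[OF G] .
  have fin': "finite ?V" "finite ?E" using fin by (auto simp: delete_vertex_edges_def)
  obtain S where S: "independent V E S" "v \<notin> S" "card S = independence_number ?V ?E"
    using independence_number_attained[OF fin'(1), of ?E]
    unfolding max_independent_def independent_delete_vertex by blast
  obtain M where M: "matching E M" "v \<notin> \<Union>M" "card M = matching_number ?E"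
    using matching_number_attained[OF fin'(2)] unfolding matching_delete_vertex by blast
  have le: "independence_number ?V ?E \<le> independence_number V E" "matching_number ?E \<le> matching_number E"
    using card_le_independence_number[OF fin(1) S(1)] card_le_matching_number[OF fin(2) M(1)] S M by auto
  have a: "independence_number ?V ?E = independence_number V E \<longleftrightarrow> v \<notin> core V E"
  proof
    assume "independence_number ?V ?E = independence_number V E"
    then show "v \<notin> core V E" using S unfolding core_def max_independent_def by auto
  next
    assume "v \<notin> core V E"
    then obtain S' where "independent V E S'" "card S' = independence_number V E" "v \<notin> S'"
      unfolding core_def max_independent_def by auto
    then show "independence_number ?V ?E = independence_number V E"
      using card_le_independence_number[OF fin'(1), of ?E S'] le(1)
      unfolding independent_delete_vertex by simp
  qed
  have b: "matching_number ?E = matching_number E \<longleftrightarrow>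
      (\<exists>M. matching E M \<and> card M = matching_number E \<and> v \<notin> \<Union>M)"
  proof
    assume "matching_number ?E = matching_number E"
    then show "\<exists>M. matching E M \<and> card M = matching_number E \<and> v \<notin> \<Union>M" using M by auto
  next
    assume "\<exists>M. matching E M \<and> card M = matching_number E \<and> v \<notin> \<Union>M"
    then obtain M' where "matching E M'" "card M' = matching_number E" "v \<notin> \<Union>M'" by blast
    then show "matching_number ?E = matching_number E"
      using card_le_matching_number[OF fin'(2), of M'] le(2)
      unfolding matching_delete_vertex by simp
  qed
  have "card ?V + 1 = card V" using v fin by (metis Suc_eq_plus1 card_Suc_Diff1)
  then show ?thesis unfolding konig_egervary_def a[symmetric] b[symmetric] using le defect by linarith
qed

lemma matching_of_injection:
  assumes "inj_on g T" "g ` T \<inter> T = {}" "\<And>t. t \<in> T \<Longrightarrow> {t, g t} \<in> E"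
  defines "M \<equiv> (\<lambda>t. {t, g t}) ` T"
  shows "matching E M" "card M = card T" "\<Union>M = T \<union> g ` T"
proof -
  show "matching E M"
    unfolding matching_def pairwise_def disjnt_def M_def using assms(1-3) 
    by (auto simp: inj_on_def)
  have "inj_on (\<lambda>t. {t, g t}) T" using assms(2) by (auto simp: inj_on_def doubleton_eq_iff)
  then show "card M = card T" unfolding M_def by (rule card_image)
  show "\<Union>M = T \<union> g ` T" unfolding M_def by auto
qed

lemma matching_Un:
  assumes "matching E M" "matching E N" "\<Union>M \<inter> \<Union>N = {}" "finite E" "\<And>e. e \<in> E \<Longrightarrow> card e = 2"
  shows "matching E (M \<union> N)" "card (M \<union> N) = card M + card N"
proof -
  have "disjnt e f" if "e \<in> M" "f \<in> N" for e f
    using that assms(3) unfolding disjnt_def by blast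
  then show "matching E (M \<union> N)"
    using assms(1,2) unfolding matching_def pairwise_def by (auto simp: disjnt_sym)
  have "e = {}" if "e \<in> M" "e \<in> N" for e using that assms(3) by blast
  then have "M \<inter> N = {}" using assms(1,5) unfolding matching_def by fastforce
  then show "card (M \<union> N) = card M + card N"
    using assms(1,2,4) unfolding matching_def by (intro card_Un_disjoint) (auto intro: finite_subset)
qed

lemma card_matching_inside:
  assumes "matching E M" "finite Z" "\<Union>M \<subseteq> Z" "\<And>e. e \<in> E \<Longrightarrow> card e = 2"
  shows "2 * card M \<le> card Z"
proof -
  have "card (\<Union>M) = sum card M"
    using assms unfolding matching_def
    by (intro card_Union_disjoint) (auto simp: pairwise_def intro: finite_subset)
  also have "\<dots> = 2 * card M" using assms(1,4) by (simp add: matching_def subset_iff)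
  finally show ?thesis using card_mono[OF assms(2,3)] by simp
qed

text \<open>Edges of a matching that meet \<open>T\<close> have distinct endpoints in \<open>T\<close>. Counting only the covered
  part of \<open>T\<close> on the right makes it possible to conclude later that maximum matchings cover
  certain sets completely.\<close>

lemma card_matching_touching:
  assumes "matching E M" "finite T"
  shows "card {e \<in> M. e \<inter> T \<noteq> {}} \<le> card (T \<inter> \<Union>M)"
proof (rule card_inj_on_le)
  let ?p = "\<lambda>e. SOME t. t \<in> e \<inter> T"
  have p: "?p e \<in> e \<inter> T" if "e \<inter> T \<noteq> {}" for e
    using that by (metis ex_in_conv someI_ex)
  show "inj_on ?p {e \<in> M. e \<inter> T \<noteq> {}}"
  proof (rule inj_onI, rule ccontr)
    fix e f assume *: "e \<in> {e \<in> M. e \<inter> T \<noteq> {}}" "f \<in> {e \<in> M. e \<inter> T \<noteq> {}}" "?p e = ?p f" "e \<noteq> f"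
    then have "disjnt e f" using assms(1) unfolding matching_def pairwise_def by blast
    then show False using p[of e] p[of f] * unfolding disjnt_def by auto
  qed
  show "?p ` {e \<in> M. e \<inter> T \<noteq> {}} \<subseteq> T \<inter> \<Union>M" using p by blast
  show "finite (T \<inter> \<Union>M)" using assms(2) by simp
qed


lemma critical_difference_attained:
  assumes "finite V"
  shows "\<exists>I. critical_independent V E I"
    and "independent V E I \<Longrightarrow> difference V E I \<le> critical_difference V E"
proof -
  have "{difference V E I |I. independent V E I} \<subseteq> difference V E ` Pow V"
    by (auto simp: independent_def)
  then have fin: "finite {difference V E I |I. independent V E I}" using assms finite_subset by blast
  have "independent V E {}" by (simp add: independent_def)
  then have ne: "{difference V E I |I. independent V E I} \<noteq> {}" by blast
  show "\<exists>I. critical_independent V E I"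
    using Max_in[OF fin ne] unfolding critical_independent_def critical_difference_def by auto
  show "difference V E I \<le> critical_difference V E" if "independent V E I"
    unfolding critical_difference_def using that by (intro Max_ge[OF fin]) auto
qed

section \<open>Splitting off a critical independent set\<close>

text \<open>What the choice of \<open>I\<close> as a largest critical independent set with neighbourhood \<open>T\<close> provides.
  In \<open>expand\<close> and below, \<open>independent Z E\<close> and \<open>neighbors Z E\<close> refer to the subgraph
  induced on \<open>Z\<close>; likewise \<open>neighbors I E W\<close> is the part of the neighbourhood of \<open>W\<close> in \<open>I\<close>.\<close>

locale critical_split =
  fixes V :: "'a set" and E :: "'a set set" and I T Z :: "'a set" and m :: "'a \<Rightarrow> 'a"
  assumes G: "simple_graph V E"
    and V_eq: "V = I \<union> T \<union> Z"
    and disj: "I \<inter> T = {}" "I \<inter> Z = {}" "T \<inter> Z = {}"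
    and I_edge: "\<And>u v. u \<in> I \<Longrightarrow> v \<in> I \<union> Z \<Longrightarrow> {u, v} \<notin> E"
    and m_inj: "inj_on m T" and m_img: "m ` T \<subseteq> I" and m_edge: "\<And>t. t \<in> T \<Longrightarrow> {t, m t} \<in> E"
    and expand: "\<And>J. independent Z E J \<Longrightarrow> J \<noteq> {} \<Longrightarrow> card J < card (neighbors Z E J)"
begin

lemma fin: "finite V" "finite E" "finite I" "finite T" "finite Z"
  using simple_graph_finite[OF G] V_eq by auto

lemma edge_sub: "e \<in> E \<Longrightarrow> e \<subseteq> V" and edge_card: "e \<in> E \<Longrightarrow> card e = 2"
  using G unfolding simple_graph_def by auto

lemma card_T_le: "card T \<le> card I"
  using card_inj_on_le[OF m_inj m_img fin(3)] .

lemma card_V: "card V = card I + card T + card Z"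
  unfolding V_eq using fin disj by (simp add: card_Un_disjoint Int_Un_distrib2)

lemma expand_weak: "independent Z E J \<Longrightarrow> card J \<le> card (neighbors Z E J)"
  using expand[of J] by (cases "J = {}") auto

text \<open>An independent set contains at most one of \<open>t\<close> and \<open>m t\<close>, so its part in \<open>I\<close> lies in the
  complement of the partners of its part in \<open>T\<close>. Equality of sizes then determines the part
  in \<open>I\<close> completely.\<close>

lemma card_IT_split:
  assumes "independent V E S"
  shows "card (S \<inter> (I \<union> T)) \<le> card I"
    and "card (S \<inter> (I \<union> T)) = card I \<Longrightarrow> S \<inter> (I \<union> T) = (S \<inter> T) \<union> (I - m ` (S \<inter> T))"
proof -
  let ?X = "(S \<inter> T) \<union> (I - m ` (S \<inter> T))"
  have sub: "S \<inter> (I \<union> T) \<subseteq> ?X" using assms m_edge unfolding independent_def by blast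
  have fX: "finite ?X" using fin by auto
  have "card (m ` (S \<inter> T)) = card (S \<inter> T)" using m_inj by (meson card_image inj_on_subset inf_le2)
  moreover have "m ` (S \<inter> T) \<subseteq> I" using m_img by blast
  moreover have "card ?X = card (S \<inter> T) + card (I - m ` (S \<inter> T))"
    using fin disj by (intro card_Un_disjoint) auto
  ultimately have X: "card ?X = card I"
    using fin card_mono[of I "m ` (S \<inter> T)"] by (simp add: card_Diff_subset)
  show "card (S \<inter> (I \<union> T)) \<le> card I" using card_mono[OF fX sub] X by simp
  show "S \<inter> (I \<union> T) = ?X" if "card (S \<inter> (I \<union> T)) = card I"
    using card_subset_eq[OF fX sub] that X by simp
qed

lemma card_independent_split:
  assumes "independent V E S"
  shows "card S = card (S \<inter> (I \<union> T)) + card (S \<inter> Z)"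
proof -
  have "S = (S \<inter> (I \<union> T)) \<union> (S \<inter> Z)" using assms V_eq unfolding independent_def by blast
  then show ?thesis using fin disj
    by (metis (no_types, lifting) Int_Un_distrib2 Int_left_commute Un_empty card_Un_disjoint finite_Int finite_UnI inf.assoc inf_bot_right inf_commute)
qed

lemma independent_in_Z: "independent V E S \<Longrightarrow> independent Z E (S \<inter> Z)"
  unfolding independent_def by blast

text \<open>The sets that can take over the role of \<open>I\<close> in the splitting, with \<open>I \<union> T\<close> and \<open>Z\<close>
  unchanged.\<close>

definition exchange :: "'a set \<Rightarrow> bool" where
  "exchange J \<longleftrightarrow> J \<subseteq> I \<union> T \<and> independent V E J \<and> card J = card I \<and> neighbors Z E J = {}"

lemma exchange_I: "exchange I"
  using I_edge V_eq unfolding exchange_def independent_def neighbors_def by auto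

lemma exchange_eq:
  assumes "exchange J"
  shows "J = (J \<inter> T) \<union> (I - m ` (J \<inter> T))"
proof -
  have "J \<inter> (I \<union> T) = J" using assms unfolding exchange_def by blast
  then show ?thesis using card_IT_split(2)[of J] assms unfolding exchange_def by metis
qed

lemma exchange_matched_iff:
  assumes "exchange J" "t \<in> T"
  shows "m t \<in> J \<longleftrightarrow> t \<notin> J"
proof -
  have "m t \<in> I" "m t \<notin> T" using assms m_img disj by auto
  moreover have "m t \<in> m ` (J \<inter> T) \<longleftrightarrow> t \<in> J"
    using m_inj assms(2) by (auto simp: inj_on_def)
  moreover have "m t \<in> J \<longleftrightarrow> m t \<in> (J \<inter> T) \<union> (I - m ` (J \<inter> T))"
    using exchange_eq[OF assms(1)] by blast
  ultimately show ?thesis by blast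
qed

text \<open>The neighbourhood of \<open>J\<close> contains the \<open>m\<close>-partners of the matched elements of \<open>J\<close> and the
  neighbours in \<open>Z\<close> of \<open>J \<inter> Z\<close>; only the \<open>|I| - |T|\<close> unmatched vertices of \<open>I\<close> contribute to
  \<open>J\<close> without contributing a neighbour. In case of equality, strict expansion in \<open>Z\<close> excludes that
  \<open>J\<close> meets \<open>Z\<close>, and \<open>J\<close> has only the neighbours listed. In particular none is in \<open>Z\<close>, so adding
  to \<open>J\<close> all vertices of \<open>I\<close> not adjacent to it gives an exchange set.\<close>

lemma difference_bound:
  assumes J: "independent V E J"
  shows "difference V E J \<le> int (card I) - int (card T)"
    and "difference V E J = int (card I) - int (card T) \<Longrightarrow> \<exists>K. exchange K \<and> J \<subseteq> K"
proof -
  let ?A = "m ` (J \<inter> T)" and ?B = "{t \<in> T. m t \<in> J}" and ?C = "neighbors Z E (J \<inter> Z)"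
  let ?N = "?A \<union> ?B \<union> ?C"
  have JV: "J \<subseteq> V" using J unfolding independent_def by blast
  have finN: "finite (neighbors V E J)" using fin unfolding neighbors_def by auto
  have sub: "?N \<subseteq> neighbors V E J"
    using m_edge m_img V_eq unfolding neighbors_def by (fastforce simp: insert_commute)
  have AI: "?A \<subseteq> I" using m_img by blast
  have cA: "card ?A = card (J \<inter> T)" using m_inj by (meson card_image inj_on_subset inf_le2)
  have CZ: "?C \<subseteq> Z" unfolding neighbors_def by blast
  have "?A \<inter> ?B = {}" "(?A \<union> ?B) \<inter> ?C = {}" using AI CZ disj by blast+
  then have cN: "card ?N = card (J \<inter> T) + card ?B + card ?C"
    using fin cA finite_subset[OF AI] finite_subset[OF CZ] by (simp add: card_Un_disjoint)
  have "J \<inter> I \<subseteq> m ` ?B \<union> (I - m ` T)" by blast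
  then have "card (J \<inter> I) \<le> card (m ` ?B \<union> (I - m ` T))" using fin by (intro card_mono) auto
  also have "\<dots> \<le> card (m ` ?B) + card (I - m ` T)" by (rule card_Un_le)
  also have "\<dots> \<le> card ?B + (card I - card T)"
    using fin m_img card_image[OF m_inj] by (simp add: card_Diff_subset card_image_le)
  finally have cI: "card (J \<inter> I) + card T \<le> card ?B + card I" using card_T_le by simp
  have "J = (J \<inter> I) \<union> (J \<inter> T) \<union> (J \<inter> Z)" using JV V_eq by blast
  moreover have "card ((J \<inter> I) \<union> (J \<inter> T) \<union> (J \<inter> Z)) = card (J \<inter> I) + card (J \<inter> T) + card (J \<inter> Z)"
    using fin disj by (subst card_Un_disjoint, simp, simp, blast, subst card_Un_disjoint) auto
  ultimately have cJ: "card J = card (J \<inter> I) + card (J \<inter> T) + card (J \<inter> Z)" by simp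
  have cZ: "card (J \<inter> Z) \<le> card ?C" using expand_weak independent_in_Z[OF J] by blast
  have cNle: "card ?N \<le> card (neighbors V E J)" using card_mono[OF finN sub] .
  show "difference V E J \<le> int (card I) - int (card T)"
    using cN cI cJ cZ cNle unfolding difference_def by linarith
  assume eq: "difference V E J = int (card I) - int (card T)"
  have "card (J \<inter> Z) = card ?C" "card ?N = card (neighbors V E J)"
    using eq cN cI cJ cZ cNle unfolding difference_def by linarith+
  then have JZ: "J \<inter> Z = {}" and N: "neighbors V E J = ?N"
    using expand[OF independent_in_Z[OF J]] card_subset_eq[OF finN sub] by auto
  have C: "?C = {}" unfolding JZ neighbors_def by simp
  let ?K = "(J \<inter> T) \<union> (I - ?A)"
  have NI: "neighbors V E J \<subseteq> ?A \<union> T" using N C by blast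
  have JI: "J \<inter> I \<subseteq> I - ?A" using J m_edge unfolding independent_def by blast
  have noedge: "{u, v} \<notin> E" if "u \<in> J" "v \<in> I - ?A" for u v
    using that NI disj V_eq unfolding neighbors_def by blast
  then have noedge': "{v, u} \<notin> E" if "u \<in> J" "v \<in> I - ?A" for u v
    using that by (metis insert_commute)
  have "exchange ?K"
    unfolding exchange_def
  proof (intro conjI)
    show "independent V E ?K"
      using J noedge noedge' I_edge V_eq unfolding independent_def by blast
    have "card ?K = card (J \<inter> T) + card (I - ?A)" using fin disj by (intro card_Un_disjoint) auto
    then show "card ?K = card I"
      using fin AI cA card_mono[OF fin(3) AI] by (simp add: card_Diff_subset finite_subset)
    have "{u, z} \<notin> E" if "u \<in> J" "z \<in> Z" for u z
    proof
      assume "{u, z} \<in> E"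
      then have "z \<in> neighbors V E J" using that V_eq unfolding neighbors_iff by blast
      then show False using NI AI disj that(2) by blast
    qed
    then show "neighbors Z E ?K = {}" using I_edge unfolding neighbors_def by blast
  qed blast
  moreover have "J \<subseteq> ?K" using JZ JI JV V_eq by blast
  ultimately show "\<exists>K. exchange K \<and> J \<subseteq> K" by blast
qed

lemma exchange_difference:
  assumes "exchange K"
  shows "difference V E K = int (card I) - int (card T)"
proof -
  have K: "K \<subseteq> I \<union> T" "independent V E K" "card K = card I" "neighbors Z E K = {}"
    using assms unfolding exchange_def by auto
  have "neighbors V E K \<subseteq> (I \<union> T) - K"
    using K(2,4) V_eq unfolding neighbors_def independent_def by blast
  then have "card (neighbors V E K) \<le> card ((I \<union> T) - K)" using fin by (intro card_mono) auto
  also have "\<dots> = card T"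
    using K fin disj by (simp add: card_Diff_subset finite_subset card_Un_disjoint)
  finally show ?thesis using difference_bound(1)[OF K(2)] K(3) unfolding difference_def by linarith
qed

lemma critical_difference_eq: "critical_difference V E = int (card I) - int (card T)"
proof (rule antisym)
  obtain J where "critical_independent V E J"
    using critical_difference_attained(1)[OF fin(1)] by blast
  then show "critical_difference V E \<le> int (card I) - int (card T)"
    using difference_bound(1)[of J] unfolding critical_independent_def by simp
  have "independent V E I" using exchange_I unfolding exchange_def by blast
  from critical_difference_attained(2)[OF fin(1) this]
  show "int (card I) - int (card T) \<le> critical_difference V E"
    using exchange_difference[OF exchange_I] by simp
qed

lemma diadem_eq: "diadem V E = \<Union>{K. exchange K}"
proof -
  have "critical_independent V E K" if "exchange K" for K
    using that exchange_difference[OF that]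
    unfolding critical_independent_def critical_difference_eq exchange_def by blast
  moreover have "\<exists>K. exchange K \<and> J \<subseteq> K" if "critical_independent V E J" for J
    using that difference_bound(2)[of J] unfolding critical_independent_def critical_difference_eq by blast
  ultimately show ?thesis unfolding diadem_def by blast
qed

text \<open>The diadem contains \<open>I\<close>. As an exchange set contains exactly one of \<open>t\<close> and \<open>m t\<close>, the
  rest of the diadem corresponds under \<open>m\<close> to the vertices of \<open>I\<close> that some exchange set
  avoids.\<close>

lemma beta_eq: "beta V E = card I + card {v \<in> I. \<exists>K. exchange K \<and> v \<notin> K}"
proof -
  let ?P = "{v \<in> I. \<exists>K. exchange K \<and> v \<notin> K}" and ?D = "{t \<in> T. \<exists>K. exchange K \<and> t \<in> K}"
  have "?P = m ` ?D"
  proof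
    show "m ` ?D \<subseteq> ?P" using exchange_matched_iff m_img by blast
    show "?P \<subseteq> m ` ?D"
    proof
      fix v assume "v \<in> ?P"
      then obtain K where K: "v \<in> I" "exchange K" "v \<notin> K" by blast
      then obtain t where "t \<in> T" "v = m t" "t \<in> K" using exchange_eq[OF K(2)] by blast
      then show "v \<in> m ` ?D" using K(2) by blast
    qed
  qed
  moreover have "inj_on m ?D" using m_inj by (auto simp: inj_on_def)
  ultimately have "card ?P = card ?D" by (simp add: card_image)
  moreover have "diadem V E = I \<union> ?D"
    unfolding diadem_eq using exchange_I unfolding exchange_def by auto
  moreover have "card (I \<union> ?D) = card I + card ?D" using fin disj by (intro card_Un_disjoint) auto
  ultimately show ?thesis unfolding beta_def by simp
qed

text \<open>Expansion gives each nonempty subset of \<open>P\<close> one neighbour in \<open>Z\<close> more than Hall's condition asks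
  for, which leaves room to forbid \<open>y\<close>.\<close>

lemma matching_of_independent_avoiding:
  assumes P: "independent Z E P" and y: "y \<in> Z" "y \<notin> P"
  shows "\<exists>M. matching E M \<and> card M = card P \<and> \<Union>M \<subseteq> Z - {y}"
proof -
  let ?A = "\<lambda>p. neighbors Z E {p} - {y}"
  have PZ: "P \<subseteq> Z" using P unfolding independent_def by blast
  have "\<exists>f. inj_on f P \<and> (\<forall>p\<in>P. f p \<in> ?A p)"
  proof (rule hall_distinct_representatives)
    show "finite P" using PZ fin(5) finite_subset by blast
    show "finite (?A p)" for p using fin(5) unfolding neighbors_def by simp
    fix J assume J: "J \<subseteq> P"
    have eq: "\<Union>(?A ` J) = neighbors Z E J - {y}" unfolding neighbors_def by blast
    show "card J \<le> card (\<Union>(?A ` J))"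
    proof (cases "J = {}")
      case False
      have "independent Z E J" using P J unfolding independent_def by blast
      then have "card J < card (neighbors Z E J)" using expand False by blast
      moreover have "card (neighbors Z E J) - card {y} \<le> card (neighbors Z E J - {y})"
        by (rule diff_card_le_card_Diff) simp
      ultimately show ?thesis unfolding eq by simp
    qed simp
  qed
  then obtain f where f: "inj_on f P" "\<And>p. p \<in> P \<Longrightarrow> f p \<in> Z" "\<And>p. p \<in> P \<Longrightarrow> {p, f p} \<in> E"
    "\<And>p. p \<in> P \<Longrightarrow> f p \<noteq> y"
    unfolding neighbors_def by auto
  have "f ` P \<inter> P = {}" using f(3) P unfolding independent_def by blast
  note M = matching_of_injection[OF f(1) this f(3)]
  show ?thesis
    using M PZ y f(2,4) by (intro exI[of _ "(\<lambda>t. {t, f t}) ` P"]) auto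
qed

end

text \<open>By \<open>matching_of_independent_avoiding\<close> and \<open>avoid\<close>, the graph induced on \<open>Z\<close> is
  factor-critical: for each \<open>z \<in> Z\<close> it has a matching that covers everything in \<open>Z\<close> but \<open>z\<close>.\<close>

locale odd_critical_split = critical_split +
  fixes k :: nat
  assumes card_Z: "card Z = Suc (2 * k)"
    and avoid: "\<And>z. z \<in> Z \<Longrightarrow> \<exists>S. independent Z E S \<and> card S = k \<and> z \<notin> S"
begin

lemma Z_nonempty: "Z \<noteq> {}"
  using card_Z by auto

lemma card_independent_Z_le:
  assumes "independent Z E J"
  shows "card J \<le> k"
proof (cases "J = {}")
  case False
  have J: "J \<subseteq> Z" "J \<inter> neighbors Z E J = {}" "neighbors Z E J \<subseteq> Z"
    using assms unfolding independent_def neighbors_def by blast+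
  then have "card J + card (neighbors Z E J) = card (J \<union> neighbors Z E J)"
    using fin(5) finite_subset by (metis card_Un_disjoint)
  also have "\<dots> \<le> card Z" using J fin(5) by (intro card_mono) auto
  finally show ?thesis using expand[OF assms False] card_Z by simp
qed simp

lemma exchange_Un_independent:
  assumes "exchange K" "independent Z E S" "card S = k"
  shows "independent V E (K \<union> S)" "card (K \<union> S) = card I + k"
proof -
  have no: "{u, v} \<notin> E" if "u \<in> K" "v \<in> S" for u v
  proof
    assume "{u, v} \<in> E"
    moreover have "v \<in> Z" using that(2) assms(2) unfolding independent_def by blast
    ultimately have "v \<in> neighbors Z E K" using that(1) unfolding neighbors_iff by blast
    then show False using assms(1) unfolding exchange_def by simp
  qed
  then have no': "{v, u} \<notin> E" if "u \<in> K" "v \<in> S" for u v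
    using that by (metis insert_commute)
  have sub: "K \<subseteq> I \<union> T" "S \<subseteq> Z" using assms unfolding exchange_def independent_def by auto
  have "{u, v} \<notin> E" if "u \<in> K" "v \<in> K" for u v
    using assms(1) that unfolding exchange_def independent_def by blast
  moreover have "{u, v} \<notin> E" if "u \<in> S" "v \<in> S" for u v
    using assms(2) that unfolding independent_def by blast
  ultimately have "{u, v} \<notin> E" if "u \<in> K \<union> S" "v \<in> K \<union> S" for u v
    using that no[of u v] no'[of v u] by (metis UnE)
  moreover have "K \<union> S \<subseteq> V" using sub V_eq by auto
  ultimately show "independent V E (K \<union> S)" unfolding independent_def by simp
  have "K \<inter> S = {}" using sub disj by blast
  then have "card (K \<union> S) = card K + card S"
    using sub fin by (intro card_Un_disjoint) (auto intro: finite_subset)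
  then show "card (K \<union> S) = card I + k" using assms unfolding exchange_def by simp
qed

lemma independence_number_eq: "independence_number V E = card I + k"
proof -
  obtain z where "z \<in> Z" using Z_nonempty by blast
  then obtain S where S: "independent Z E S" "card S = k" using avoid by blast
  show ?thesis
  proof (rule independence_number_eqI[OF fin(1) exchange_Un_independent[OF exchange_I S]])
    fix S assume "independent V E S"
    then show "card S \<le> card I + k"
      using card_independent_split[of S] card_IT_split(1)[of S]
        card_independent_Z_le[OF independent_in_Z, of S] by linarith
  qed
qed

lemma exchange_Un_max_independent:
  assumes "exchange K" "independent Z E S" "card S = k"
  shows "max_independent V E (K \<union> S)"
  using exchange_Un_independent[OF assms] independence_number_eq unfolding max_independent_def by simp

lemma core_subset: "core V E \<subseteq> I"
proof
  fix v assume v: "v \<in> core V E"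
  obtain z where "z \<in> Z" using Z_nonempty by blast
  then obtain S where S: "independent Z E S" "card S = k" using avoid by blast
  have "v \<in> I \<union> S" using v exchange_Un_max_independent[OF exchange_I S] unfolding core_def by blast
  moreover have "v \<notin> Z"
  proof
    assume "v \<in> Z"
    then obtain S' where S': "independent Z E S'" "card S' = k" "v \<notin> S'" using avoid by blast
    then have "v \<in> I \<union> S'"
      using v exchange_Un_max_independent[OF exchange_I S'(1,2)] unfolding core_def by blast
    then show False using S' disj \<open>v \<in> Z\<close> by blast
  qed
  ultimately show "v \<in> I" using S unfolding independent_def by blast
qed

lemma exchange_core:
  assumes "exchange K"
  shows "core V E \<subseteq> K"
proof
  fix v assume v: "v \<in> core V E"
  obtain z where "z \<in> Z" using Z_nonempty by blast
  then obtain S where S: "independent Z E S" "card S = k" using avoid by blast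
  have "v \<in> K \<union> S" using v exchange_Un_max_independent[OF assms S] unfolding core_def by blast
  moreover have "v \<notin> Z" using core_subset v disj by blast
  ultimately show "v \<in> K" using S unfolding independent_def by blast
qed

text \<open>Since \<open>K\<close> is independent and has no neighbours in \<open>Z\<close>, each edge either meets \<open>(I \<union> T) - K\<close>
  or lies inside \<open>Z\<close>, and \<open>2k + 1\<close> vertices have room for at most \<open>k\<close> disjoint edges.\<close>

lemma card_matching_le:
  assumes K: "exchange K" and M: "matching E M"
  shows "card M \<le> card (((I \<union> T) - K) \<inter> \<Union>M) + k"
proof -
  let ?T = "(I \<union> T) - K" and ?M = "{e \<in> M. e \<subseteq> Z}"
  have finM: "finite M" using M fin finite_subset unfolding matching_def by blast
  have "e \<subseteq> Z" if e: "e \<in> M" "e \<inter> ?T = {}" for e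
  proof -
    have eE: "e \<in> E" using e M unfolding matching_def by blast
    then obtain u v where uv: "e = {u, v}" using edge_card by (meson card_2_iff)
    then have "{v, u} \<in> E" "{u, v} \<in> E" using eE by (auto simp: insert_commute)
    moreover have "{u, v} \<subseteq> K \<union> Z" using uv e edge_sub[OF eE] V_eq by blast
    moreover have "{x, y} \<notin> E" if "x \<in> K" "y \<in> K" for x y
      using K that unfolding exchange_def independent_def by blast
    moreover have "{x, y} \<notin> E" if "x \<in> K" "y \<in> Z" for x y
      using K that neighbors_iff[of y Z E K] unfolding exchange_def by auto
    ultimately show ?thesis using uv by blast
  qed
  then have "M \<subseteq> {e \<in> M. e \<inter> ?T \<noteq> {}} \<union> ?M" by blast
  then have "card M \<le> card ({e \<in> M. e \<inter> ?T \<noteq> {}} \<union> ?M)" using finM by (intro card_mono) auto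
  also have "\<dots> \<le> card {e \<in> M. e \<inter> ?T \<noteq> {}} + card ?M" by (rule card_Un_le)
  also have "card {e \<in> M. e \<inter> ?T \<noteq> {}} \<le> card (?T \<inter> \<Union>M)"
    using card_matching_touching[OF M] fin by simp
  also have "card ?M \<le> k"
  proof -
    have "matching E ?M" using M unfolding matching_def pairwise_def by blast
    then have "2 * card ?M \<le> card Z" using fin edge_card by (intro card_matching_inside) auto
    then show ?thesis using card_Z by simp
  qed
  finally show ?thesis by simp
qed

lemma card_exchange_complement:
  assumes "exchange K"
  shows "card ((I \<union> T) - K) = card T"
proof -
  have K: "K \<subseteq> I \<union> T" "card K = card I" using assms unfolding exchange_def by auto
  then have "finite K" using fin by (auto intro: finite_subset)
  then show ?thesis using K fin disj by (simp add: card_Diff_subset card_Un_disjoint)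
qed

text \<open>The matching consists of the edges \<open>{t, g t}\<close> and a perfect matching of \<open>Z - {z}\<close>. Allowing
  \<open>z\<close> as a value of \<open>g\<close> matters: one vertex of \<open>T\<close> may be matched into \<open>Z\<close>, which frees
  a further vertex of \<open>I\<close>.\<close>

lemma matching_of_T_and_Z:
  assumes g: "inj_on g T" "g ` T \<subseteq> I \<union> {z}" "\<And>t. t \<in> T \<Longrightarrow> {t, g t} \<in> E" and z: "z \<in> Z"
  shows "\<exists>M. matching E M \<and> card M = card T + k \<and> \<Union>M \<subseteq> T \<union> g ` T \<union> (Z - {z})"
proof -
  obtain P where "independent Z E P" "card P = k" "z \<notin> P" using avoid[OF z] by blast
  then obtain N where N: "matching E N" "card N = k" "\<Union>N \<subseteq> Z - {z}"
    using matching_of_independent_avoiding z by blast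
  have "g ` T \<inter> T = {}" using g(2) z disj by blast
  note M = matching_of_injection[OF g(1) this g(3)]
  let ?M = "(\<lambda>t. {t, g t}) ` T"
  have "\<Union>?M \<inter> \<Union>N = {}" unfolding M(3) using N(3) g(2) disj by blast
  note U = matching_Un[OF M(1) N(1) this fin(2) edge_card]
  have "\<Union>(?M \<union> N) \<subseteq> T \<union> g ` T \<union> (Z - {z})"
    using M(3) N(3) by blast
  then show ?thesis using U M(2) N(2) by metis
qed

lemma matching_number_eq: "matching_number E = card T + k"
proof -
  obtain z where z: "z \<in> Z" using Z_nonempty by blast
  have "m ` T \<subseteq> I \<union> {z}" using m_img by auto
  then obtain M where M: "matching E M" "card M = card T + k"
    using matching_of_T_and_Z[OF m_inj _ m_edge z] by blast
  show ?thesis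
  proof (rule matching_number_eqI[OF fin(2) M])
    fix N assume N: "matching E N"
    have "card (((I \<union> T) - I) \<inter> \<Union>N) \<le> card ((I \<union> T) - I)" using fin by (intro card_mono) auto
    then show "card N \<le> card T + k"
      using card_matching_le[OF exchange_I N] card_exchange_complement[OF exchange_I] by simp
  qed
qed

text \<open>A maximum matching attains the bound of \<open>card_matching_le\<close> for every exchange set at
  once.\<close>

lemma exchange_complement_covered:
  assumes K: "exchange K" and M: "matching E M" "card M = matching_number E"
  shows "(I \<union> T) - K \<subseteq> \<Union>M"
proof -
  let ?T = "(I \<union> T) - K"
  have "card ?T \<le> card (?T \<inter> \<Union>M)"
    using card_matching_le[OF K M(1)] M(2) matching_number_eq card_exchange_complement[OF K] by simp
  then have "?T \<inter> \<Union>M = ?T" using fin by (intro card_seteq) auto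
  then show ?thesis by blast
qed

lemma Z_missed:
  assumes "z \<in> Z"
  shows "\<exists>M. matching E M \<and> card M = matching_number E \<and> z \<notin> \<Union>M"
proof -
  have "m ` T \<subseteq> I \<union> {z}" using m_img by auto
  then obtain M where M: "matching E M" "card M = card T + k" "\<Union>M \<subseteq> T \<union> m ` T \<union> (Z - {z})"
    using matching_of_T_and_Z[OF m_inj _ m_edge assms] by blast
  have "z \<notin> T" "z \<notin> m ` T" using assms m_img disj by auto
  then have "z \<notin> \<Union>M" using M(3) by blast
  then show ?thesis using M(1,2) matching_number_eq by metis
qed

text \<open>Here \<open>W\<close> is a set for which Hall's condition is tight, so that its neighbours in \<open>I\<close> are just
  its \<open>m\<close>-partners and nothing outside \<open>W\<close> and these partners obstructs an exchange. A maximum independent set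
  \<open>S\<close> contains exactly one vertex of each pair \<open>t\<close>, \<open>m t\<close>. Following \<open>S\<close> on the pairs from \<open>W\<close>, and \<open>I\<close>
  elsewhere, gives an exchange set, and it avoids \<open>v\<close> because \<open>S\<close> does.\<close>

lemma exchange_avoiding_of_tight:
  assumes W: "W \<subseteq> T" "card (neighbors I E W) \<le> card W" "neighbors Z E W = {}"
    and v: "v \<in> neighbors I E W" and S: "max_independent V E S" "v \<notin> S"
  shows "\<exists>K. exchange K \<and> v \<notin> K"
proof -
  let ?Q = "neighbors I E W"
  have Sind: "independent V E S" and Scard: "card S = card I + k"
    using S independence_number_eq unfolding max_independent_def by auto
  have QI: "?Q \<subseteq> I" unfolding neighbors_def by blast
  have finW: "finite W" using W fin finite_subset by blast
  have mW: "m ` W \<subseteq> ?Q" using W m_img m_edge unfolding neighbors_def by blast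
  have "card (m ` W) = card W" using m_inj W by (meson card_image inj_on_subset)
  then have Q: "?Q = m ` W"
    using card_seteq[OF finite_subset[OF QI fin(3)] mW] W(2) by simp
  have "card (S \<inter> Z) \<le> k" using card_independent_Z_le independent_in_Z[OF Sind] by blast
  then have "card (S \<inter> (I \<union> T)) = card I"
    using card_independent_split[OF Sind] card_IT_split(1)[OF Sind] Scard by simp
  note S_eq = card_IT_split(2)[OF Sind this]
  let ?K = "(S \<inter> W) \<union> (I - m ` (S \<inter> W))"
  have "v \<notin> ?K"
  proof -
    obtain t where t: "t \<in> W" "v = m t" using v Q by blast
    have "v \<in> I" "v \<notin> T" using v QI disj by auto
    then have "v \<in> m ` (S \<inter> T)" using S_eq S(2) by blast
    then obtain s where "s \<in> S \<inter> T" "m s = m t" using t by auto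
    then have "t \<in> S" using m_inj t W unfolding inj_on_def by blast
    then show ?thesis using t \<open>v \<notin> T\<close> W by blast
  qed
  moreover have "exchange ?K"
    unfolding exchange_def
  proof (intro conjI)
    have no: "{u, w} \<notin> E" if "u \<in> S \<inter> W" "w \<in> I - m ` (S \<inter> W)" for u w
    proof
      assume "{u, w} \<in> E"
      then have "w \<in> ?Q" using that unfolding neighbors_def by blast
      then have "w \<in> m ` W" "w \<notin> m ` (S \<inter> W)" using Q that by auto
      then have "w \<notin> m ` (S \<inter> T)" using m_inj W unfolding inj_on_def by blast
      then have "w \<in> S" using S_eq that by blast
      then show False using that \<open>{u, w} \<in> E\<close> Sind unfolding independent_def by blast
    qed
    then have no': "{w, u} \<notin> E" if "u \<in> S \<inter> W" "w \<in> I - m ` (S \<inter> W)" for u w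
      using that by (metis insert_commute)
    show "independent V E ?K"
      using no no' Sind I_edge W(1) V_eq unfolding independent_def by blast
    have sub: "m ` (S \<inter> W) \<subseteq> I" using m_img W by blast
    have "card (m ` (S \<inter> W)) = card (S \<inter> W)"
      using m_inj W by (meson card_image inj_on_subset inf_le2)
    moreover have "card ?K = card (S \<inter> W) + card (I - m ` (S \<inter> W))"
      using fin finW disj W by (intro card_Un_disjoint) auto
    ultimately show "card ?K = card I"
      using finW card_mono[OF fin(3) sub] sub by (simp add: card_Diff_subset)
    have "{u, z} \<notin> E" if "u \<in> W" "z \<in> Z" for u z
      using W(3) that neighbors_iff[of z Z E W] by auto
    moreover have "{u, z} \<notin> E" if "u \<in> I" "z \<in> Z" for u z using I_edge that by simp
    ultimately show "neighbors Z E ?K = {}" unfolding neighbors_def by blast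
  next
    show "?K \<subseteq> I \<union> T" using W(1) by blast
  qed
  ultimately show ?thesis by blast
qed

text \<open>A maximum matching that misses \<open>v\<close> can be built from an assignment of \<open>T\<close> to distinct vertices of
  \<open>I - {v}\<close>, except that one element of \<open>T\<close> may go to \<open>Z\<close>. If Hall's condition for this holds, the first
  alternative follows. If it fails for \<open>W\<close>, then, since \<open>m\<close> gives \<open>W\<close> at least \<open>|W|\<close> neighbours in \<open>I\<close>, the
  only possible cause is that \<open>W\<close> has exactly \<open>|W|\<close> neighbours in \<open>I\<close>, one of them \<open>v\<close>, and
  none in \<open>Z\<close>.\<close>

lemma missed_or_exchange_avoiding:
  assumes v: "v \<in> I" and S: "max_independent V E S" "v \<notin> S"
  shows "(\<exists>M. matching E M \<and> card M = matching_number E \<and> v \<notin> \<Union>M) \<or> (\<exists>K. exchange K \<and> v \<notin> K)"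
proof -
  obtain z0 where z0: "z0 \<in> Z" using Z_nonempty by blast
  \<comment> \<open>The vertex \<open>z0\<close> is a token for \<open>Z\<close> as a whole, offered to each \<open>t\<close> with a neighbour in
    \<open>Z\<close>; injectivity lets at most one \<open>t\<close> use it, and \<open>g\<close> below replaces it by an actual
    neighbour \<open>z\<close>.\<close>
  let ?A = "\<lambda>t. neighbors (I - {v}) E {t} \<union> {z \<in> {z0}. neighbors Z E {t} \<noteq> {}}"
  show ?thesis
  proof (cases "\<forall>W\<subseteq>T. card W \<le> card (\<Union>(?A ` W))")
    case True
    have "\<exists>f. inj_on f T \<and> (\<forall>t\<in>T. f t \<in> ?A t)"
    proof (rule hall_distinct_representatives)
      show "finite (?A t)" for t using fin unfolding neighbors_def by simp
      show "card W \<le> card (\<Union>(?A ` W))" if "W \<subseteq> T" for W using True that by simp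
    qed (rule fin(4))
    then obtain f where f: "inj_on f T" "\<And>t. t \<in> T \<Longrightarrow> f t \<in> ?A t" by blast
    have fz: "f t \<in> I - {v} \<and> {t, f t} \<in> E \<or> f t = z0 \<and> (\<exists>z\<in>Z. {t, z} \<in> E)" if "t \<in> T" for t
      using f(2)[OF that] unfolding neighbors_def by auto
    have "\<exists>z\<in>Z. \<forall>t\<in>T. f t = z0 \<longrightarrow> {t, z} \<in> E"
    proof (cases "\<exists>t\<in>T. f t = z0")
      case True
      then obtain t where t: "t \<in> T" "f t = z0" by blast
      then obtain z where z: "z \<in> Z" "{t, z} \<in> E" using fz[of t] z0 disj by blast
      moreover have "s = t" if "s \<in> T" "f s = z0" for s using that t f(1) unfolding inj_on_def by blast
      ultimately show ?thesis by blast
    qed (use z0 in blast)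
    then obtain z where z: "z \<in> Z" "\<And>t. t \<in> T \<Longrightarrow> f t = z0 \<Longrightarrow> {t, z} \<in> E" by blast
    define g where "g t = (if f t = z0 then z else f t)" for t
    have g: "g t \<in> (I - {v}) \<union> {z} \<and> {t, g t} \<in> E" if "t \<in> T" for t
      using fz[OF that] z that unfolding g_def by auto
    have "inj_on g T"
    proof (rule inj_onI)
      fix s t assume st: "s \<in> T" "t \<in> T" "g s = g t"
      have "f s \<noteq> z" if "f s \<noteq> z0" using fz[OF st(1)] that z(1) disj by blast
      moreover have "f t \<noteq> z" if "f t \<noteq> z0" using fz[OF st(2)] that z(1) disj by blast
      ultimately have "f s = f t" using st(3) unfolding g_def by (auto split: if_splits)
      then show "s = t" using st f(1) unfolding inj_on_def by blast
    qed
    moreover have "g ` T \<subseteq> I \<union> {z}" using g by blast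
    moreover have "{t, g t} \<in> E" if "t \<in> T" for t using g[OF that] by blast
    ultimately obtain M where "matching E M" "card M = card T + k" "\<Union>M \<subseteq> T \<union> g ` T \<union> (Z - {z})"
      using matching_of_T_and_Z[OF _ _ _ z(1), of g] by blast
    moreover have "v \<notin> T \<union> g ` T \<union> (Z - {z})"
    proof -
      have "v \<noteq> z" "v \<notin> T" "v \<notin> Z" using v z(1) disj by auto
      moreover have "v \<notin> g ` T" using g \<open>v \<noteq> z\<close> by auto
      ultimately show ?thesis by blast
    qed
    ultimately show ?thesis using matching_number_eq by (metis subsetD)
  next
    case False
    then obtain W where W: "W \<subseteq> T" "card (\<Union>(?A ` W)) < card W" by (meson not_less)
    have U: "\<Union>(?A ` W) = (neighbors I E W - {v}) \<union> {z \<in> {z0}. neighbors Z E W \<noteq> {}}"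
      unfolding neighbors_def by auto
    have "m ` W \<subseteq> neighbors I E W" using W m_img m_edge unfolding neighbors_def by blast
    moreover have finQ: "finite (neighbors I E W)" using fin unfolding neighbors_def by simp
    ultimately have ge: "card W \<le> card (neighbors I E W)"
      using m_inj W(1) by (metis card_image card_mono inj_on_subset)
    have le: "card (neighbors I E W) \<le> Suc (card (neighbors I E W - {v}))"
      using diff_card_le_card_Diff[of "{v}" "neighbors I E W"] by simp
    have Z: "neighbors Z E W = {}"
    proof (rule ccontr)
      assume "neighbors Z E W \<noteq> {}"
      then have "\<Union>(?A ` W) = insert z0 (neighbors I E W - {v})" unfolding U by auto
      moreover have "z0 \<notin> neighbors I E W - {v}" using z0 disj unfolding neighbors_def by blast
      ultimately have "card (\<Union>(?A ` W)) = Suc (card (neighbors I E W - {v}))" using finQ by simp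
      then show False using W(2) ge le by simp
    qed
    then have "\<Union>(?A ` W) = neighbors I E W - {v}" unfolding U by simp
    then have lt: "card (neighbors I E W - {v}) < card W" using W(2) by simp
    have "v \<in> neighbors I E W"
    proof (rule ccontr)
      assume "v \<notin> neighbors I E W"
      then show False using lt ge by simp
    qed
    moreover have "card (neighbors I E W) \<le> card W" using lt le by simp
    ultimately show ?thesis using exchange_avoiding_of_tight[OF W(1) _ Z _ S] by blast
  qed
qed

lemma konig_egervary_delete_iff:
  assumes "v \<in> V"
  shows "konig_egervary (V - {v}) (delete_vertex_edges E v) \<longleftrightarrow>
    v \<in> Z \<or> v \<in> I \<and> v \<notin> core V E \<and> (\<forall>K. exchange K \<longrightarrow> v \<in> K)"
proof -
  have "independence_number V E + matching_number E + 1 = card V"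
    unfolding independence_number_eq matching_number_eq card_V card_Z by simp
  note KE = konig_egervary_delete_vertex_iff[OF G assms this]
  consider "v \<in> Z" | "v \<in> T" | "v \<in> I" using assms V_eq by blast
  then show ?thesis
  proof cases
    case 1
    then show ?thesis using KE Z_missed core_subset disj by blast
  next
    case 2
    then show ?thesis using KE exchange_complement_covered[OF exchange_I] disj by blast
  next
    case 3
    have vZ: "v \<notin> Z" using 3 disj by blast
    have "(\<exists>M. matching E M \<and> card M = matching_number E \<and> v \<notin> \<Union>M) \<longleftrightarrow> (\<forall>K. exchange K \<longrightarrow> v \<in> K)"
      if core: "v \<notin> core V E"
    proof
      assume "\<exists>M. matching E M \<and> card M = matching_number E \<and> v \<notin> \<Union>M"
      then obtain M where "matching E M" "card M = matching_number E" "v \<notin> \<Union>M" by blast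
      then show "\<forall>K. exchange K \<longrightarrow> v \<in> K" using exchange_complement_covered 3 by (meson DiffI UnI1 subsetD)
    next
      assume all: "\<forall>K. exchange K \<longrightarrow> v \<in> K"
      obtain S where S: "max_independent V E S" "v \<notin> S" using core unfolding core_def by blast
      show "\<exists>M. matching E M \<and> card M = matching_number E \<and> v \<notin> \<Union>M"
        using missed_or_exchange_avoiding[OF 3 S]
      proof
        assume "\<exists>K. exchange K \<and> v \<notin> K"
        then show ?thesis using all by blast
      qed
    qed
    then have "konig_egervary (V - {v}) (delete_vertex_edges E v) \<longleftrightarrow>
      v \<notin> core V E \<and> (\<forall>K. exchange K \<longrightarrow> v \<in> K)"
      unfolding KE by (rule conj_cong[OF refl])
    then show ?thesis using 3 vZ by simp
  qed
qed

lemma rho_v_eq: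
  "rho_v V E + xi V E + beta V E = 2 * (card I + k) + 1"
proof -
  let ?P = "{v \<in> I. \<exists>K. exchange K \<and> v \<notin> K}" and ?C = "core V E"
  have "{v \<in> V. konig_egervary (V - {v}) (delete_vertex_edges E v)} = Z \<union> (I - (?C \<union> ?P))"
    (is "?L = ?R")
  proof (rule set_eqI)
    fix v
    have "v \<in> ?L \<longleftrightarrow> v \<in> V \<and> (v \<in> Z \<or> v \<in> I \<and> v \<notin> ?C \<and> (\<forall>K. exchange K \<longrightarrow> v \<in> K))"
      using konig_egervary_delete_iff[of v] by (cases "v \<in> V") simp_all
    also have "\<dots> \<longleftrightarrow> v \<in> ?R" using V_eq by auto
    finally show "v \<in> ?L \<longleftrightarrow> v \<in> ?R" .
  qed
  then have "rho_v V E = card (Z \<union> (I - (?C \<union> ?P)))" unfolding rho_v_def by simp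
  also have "\<dots> = card Z + card (I - (?C \<union> ?P))" using fin disj by (intro card_Un_disjoint) auto
  finally have r: "rho_v V E = card Z + card (I - (?C \<union> ?P))" .
  have sub: "?C \<union> ?P \<subseteq> I" using core_subset by blast
  have finCP: "finite ?C" "finite ?P" using finite_subset[OF sub fin(3)] by auto
  have "?C \<inter> ?P = {}" using exchange_core by blast
  then have "card (?C \<union> ?P) = card ?C + card ?P" by (rule card_Un_disjoint[OF finCP])
  then have rest: "card (I - (?C \<union> ?P)) + card ?C + card ?P = card I"
    using card_Diff_subset[OF finite_subset[OF sub fin(3)] sub] card_mono[OF fin(3) sub] by linarith
  have "rho_v V E + xi V E + beta V E
      = card Z + (card (I - (?C \<union> ?P)) + card ?C + card ?P) + card I"
    unfolding r xi_def beta_eq by (simp only: ac_simps)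
  also have "\<dots> = 2 * (card I + k) + 1" unfolding rest card_Z by simp
  finally show ?thesis .
qed

end


section \<open>Almost bipartite graphs that are not Koenig-Egervary\<close>

text \<open>A set \<open>W \<subseteq> T\<close> violating Hall's condition could be used to increase the difference of \<open>I\<close>, by
  removing from \<open>I\<close> the neighbours of \<open>W\<close>. A nonempty independent \<open>J \<subseteq> Z\<close> violating expansion
  could be added to \<open>I\<close> without decreasing the difference, against the choice of \<open>I\<close>.\<close>

lemma critical_split_exists:
  assumes G: "simple_graph V E"
  shows "\<exists>I T Z m. critical_split V E I T Z m"
proof -
  have finV: "finite V" using simple_graph_finite[OF G] by simp
  have "\<exists>I. critical_independent V E I \<and> (\<forall>J. critical_independent V E J \<longrightarrow> card J \<le> card I)"
  proof -
    obtain I0 where "critical_independent V E I0" using critical_difference_attained(1)[OF finV] by blast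
    moreover have "\<forall>J. critical_independent V E J \<longrightarrow> card J < Suc (card V)"
      using finV by (auto simp: critical_independent_def independent_def card_mono less_Suc_eq_le)
    ultimately show ?thesis by (rule Lattices_Big.ex_has_greatest_nat)
  qed
  then obtain I where crit: "critical_independent V E I"
    and largest: "\<And>J. critical_independent V E J \<Longrightarrow> card J \<le> card I" by blast
  define T where "T = neighbors V E I"
  define Z where "Z = V - I - T"
  have I: "independent V E I" and dI: "difference V E I = critical_difference V E"
    using crit unfolding critical_independent_def by auto
  have IV: "I \<subseteq> V" and TV: "T \<subseteq> V" and IT: "I \<inter> T = {}"
    using I unfolding independent_def T_def neighbors_def by blast+
  have fin: "finite I" "finite T" "finite Z" using IV TV finV finite_subset unfolding Z_def by auto
  have dle: "difference V E J \<le> int (card I) - int (card T)" if "independent V E J" for J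
    using critical_difference_attained(2)[OF finV that] dI unfolding difference_def T_def by simp
  have I_edge: "{u, v} \<notin> E" if "u \<in> I" "v \<in> I \<union> Z" for u v
  proof
    assume uv: "{u, v} \<in> E"
    then have "v \<notin> I" using I that(1) unfolding independent_def by blast
    then have "v \<in> Z" using that by blast
    then have "v \<in> V" "v \<notin> T" unfolding Z_def by auto
    then show False using uv that(1) unfolding T_def neighbors_def by blast
  qed
  have "\<exists>m. inj_on m T \<and> (\<forall>t\<in>T. m t \<in> neighbors I E {t})"
  proof (rule hall_distinct_representatives[OF fin(2)])
    show "finite (neighbors I E {t})" for t using fin unfolding neighbors_def by simp
    fix W assume W: "W \<subseteq> T"
    have finW: "finite W" using W fin finite_subset by blast
    have eq: "\<Union>((\<lambda>t. neighbors I E {t}) ` W) = neighbors I E W" unfolding neighbors_def by blast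
    let ?J = "I - neighbors I E W"
    have QI: "neighbors I E W \<subseteq> I" unfolding neighbors_def by blast
    have "independent V E ?J" using I unfolding independent_def by blast
    have "neighbors V E ?J \<subseteq> T - W"
    proof
      fix t assume "t \<in> neighbors V E ?J"
      then obtain u where u: "t \<in> V" "u \<in> I" "u \<notin> neighbors I E W" "{u, t} \<in> E"
        unfolding neighbors_def by blast
      then have "t \<in> T" unfolding T_def neighbors_def by blast
      moreover have "{t, u} \<in> E" using u(4) by (metis insert_commute)
      then have "t \<notin> W" using u(2,3) unfolding neighbors_def by blast
      ultimately show "t \<in> T - W" by blast
    qed
    then have "card (neighbors V E ?J) \<le> card T - card W"
      using card_mono[of "T - W"] fin finW W by (simp add: card_Diff_subset)
    moreover have "card ?J = card I - card (neighbors I E W)"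
      using QI fin by (simp add: card_Diff_subset finite_subset)
    moreover have "card (neighbors I E W) \<le> card I" "card W \<le> card T"
      using QI W fin by (auto intro: card_mono)
    ultimately have "card W \<le> card (neighbors I E W)"
      using dle[OF \<open>independent V E ?J\<close>] unfolding difference_def by linarith
    then show "card W \<le> card (\<Union>((\<lambda>t. neighbors I E {t}) ` W))" unfolding eq .
  qed
  then obtain m where m: "inj_on m T" "\<And>t. t \<in> T \<Longrightarrow> m t \<in> I \<and> {t, m t} \<in> E"
    unfolding neighbors_def by auto
  have expand: "card J < card (neighbors Z E J)" if J: "independent Z E J" "J \<noteq> {}" for J
  proof (rule ccontr)
    assume le: "\<not> card J < card (neighbors Z E J)"
    have JZ: "J \<subseteq> Z" using J unfolding independent_def by blast
    have finJ: "finite J" using JZ fin finite_subset by blast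
    have no: "{u, v} \<notin> E \<and> {v, u} \<notin> E" if "u \<in> I" "v \<in> J" for u v
      using I_edge[of u v] that JZ by (metis UnI2 insert_commute subsetD)
    have IJ: "independent V E (I \<union> J)"
      using I J no unfolding independent_def Z_def by blast
    have "neighbors V E (I \<union> J) \<subseteq> T \<union> neighbors Z E J"
    proof
      fix v assume v: "v \<in> neighbors V E (I \<union> J)"
      show "v \<in> T \<union> neighbors Z E J"
      proof (cases "v \<in> T")
        case False
        then obtain u where u: "u \<in> J" "{u, v} \<in> E" "v \<in> V"
          using v unfolding T_def neighbors_def by blast
        then have "v \<notin> I" using no by blast
        then show ?thesis using u False unfolding neighbors_def Z_def by blast
      qed simp
    qed
    moreover have "finite (neighbors Z E J)" using fin unfolding neighbors_def by simp
    ultimately have "card (neighbors V E (I \<union> J)) \<le> card (T \<union> neighbors Z E J)"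
      using fin by (intro card_mono) auto
    also have "\<dots> \<le> card T + card (neighbors Z E J)" by (rule card_Un_le)
    finally have "card (neighbors V E (I \<union> J)) \<le> card T + card J" using le by simp
    moreover have cIJ: "card (I \<union> J) = card I + card J"
      using fin finJ JZ unfolding Z_def by (intro card_Un_disjoint) auto
    ultimately have "difference V E (I \<union> J) = critical_difference V E"
      using critical_difference_attained(2)[OF finV IJ] dI unfolding difference_def T_def by linarith
    then have "card (I \<union> J) \<le> card I" using IJ largest unfolding critical_independent_def by blast
    then show False using cIJ J(2) finJ by simp
  qed
  have "critical_split V E I T Z m"
    by unfold_locales (use G IV TV IT I_edge m expand in \<open>auto simp: Z_def\<close>)
  then show ?thesis by blast
qed

context critical_split
begin

lemma konig_egervary_if_Z_empty:
  assumes Z: "Z = {}"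
  shows "konig_egervary V E"
proof -
  have I: "independent V E I" using exchange_I unfolding exchange_def by blast
  have "independence_number V E = card I"
  proof (rule independence_number_eqI[OF fin(1) I refl])
    fix S assume S: "independent V E S"
    then have "S \<inter> (I \<union> T) = S" using V_eq Z unfolding independent_def by blast
    then show "card S \<le> card I" using card_IT_split(1)[OF S] by simp
  qed
  moreover have "m ` T \<inter> T = {}" using m_img disj by blast
  note M = matching_of_injection[OF m_inj this m_edge]
  have "matching_number E = card T"
  proof (rule matching_number_eqI[OF fin(2) M(1,2)])
    fix N assume N: "matching E N"
    have "e \<inter> T \<noteq> {}" if "e \<in> N" for e
    proof
      assume e: "e \<inter> T = {}"
      have eE: "e \<in> E" using that N unfolding matching_def by blast
      then obtain u v where uv: "e = {u, v}" using edge_card by (meson card_2_iff)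
      moreover have "e \<subseteq> I" using edge_sub[OF eE] e V_eq Z by blast
      ultimately show False using I_edge[of u v] eE by blast
    qed
    then have "{e \<in> N. e \<inter> T \<noteq> {}} = N" by blast
    moreover have "card (T \<inter> \<Union>N) \<le> card T" using fin by (intro card_mono) auto
    ultimately show "card N \<le> card T" using card_matching_touching[OF N fin(4)] by simp
  qed
  ultimately show ?thesis using card_V Z unfolding konig_egervary_def by simp
qed

text \<open>Each side of a bipartition has all its neighbours on the other side, so by expansion each
  side, if nonempty, is smaller than the other.\<close>

lemma no_odd_cycle_in_Z_imp_Z_empty:
  assumes no: "\<And>C. \<not> odd_cycle {e \<in> E. e \<subseteq> Z} C"
  shows "Z = {}"
proof (rule ccontr)
  assume "Z \<noteq> {}"
  have card2: "card e = 2" if "e \<in> {e \<in> E. e \<subseteq> Z}" for e using that edge_card by blast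
  obtain X where X: "\<And>u v. {u, v} \<in> {e \<in> E. e \<subseteq> Z} \<Longrightarrow> u \<in> X \<longleftrightarrow> v \<notin> X"
    using no_odd_cycle_imp_two_colouring[OF card2 no] by blast
  let ?A = "Z \<inter> X" and ?B = "Z - X"
  have X': "u \<in> X \<longleftrightarrow> v \<notin> X" if "{u, v} \<in> E" "u \<in> Z" "v \<in> Z" for u v
    using X[of u v] that by simp
  have A: "independent Z E ?A" and B: "independent Z E ?B"
    using X' unfolding independent_def by blast+
  have "neighbors Z E ?A \<subseteq> ?B" "neighbors Z E ?B \<subseteq> ?A"
    using X' unfolding neighbors_def by blast+
  then have "card (neighbors Z E ?A) \<le> card ?B" "card (neighbors Z E ?B) \<le> card ?A"
    using fin by (auto intro: card_mono)
  moreover have "?A \<noteq> {} \<or> ?B \<noteq> {}" using \<open>Z \<noteq> {}\<close> by blast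
  ultimately show False using expand[OF A] expand[OF B] expand_weak[OF A] expand_weak[OF B] by linarith
qed

text \<open>The neighbours of one side lie on the other side or equal \<open>c\<close>, so by expansion neither side is larger
  than the other. Both are nonempty, because \<open>c\<close> has at least two neighbours in \<open>Z\<close>. Each vertex of \<open>Z\<close>
  is avoided by one of the sides, and \<open>c\<close> by both.\<close>

lemma odd_critical_split_if_bipartite_minus_vertex:
  assumes c: "c \<in> Z" and no: "\<And>C. \<not> odd_cycle {e \<in> E. e \<subseteq> Z - {c}} C"
  shows "\<exists>k. odd_critical_split V E I T Z m k"
proof -
  have card2: "card e = 2" if "e \<in> {e \<in> E. e \<subseteq> Z - {c}}" for e using that edge_card by blast
  obtain X where X: "\<And>u v. {u, v} \<in> {e \<in> E. e \<subseteq> Z - {c}} \<Longrightarrow> u \<in> X \<longleftrightarrow> v \<notin> X"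
    using no_odd_cycle_imp_two_colouring[OF card2 no] by blast
  let ?A = "(Z - {c}) \<inter> X" and ?B = "(Z - {c}) - X"
  have X': "u \<in> X \<longleftrightarrow> v \<notin> X" if "{u, v} \<in> E" "u \<in> Z - {c}" "v \<in> Z - {c}" for u v
    using X[of u v] that by simp
  have A: "independent Z E ?A" and B: "independent Z E ?B"
    using X' unfolding independent_def by blast+
  have NA: "neighbors Z E ?A \<subseteq> insert c ?B" and NB: "neighbors Z E ?B \<subseteq> insert c ?A"
    using X' unfolding neighbors_def by blast+
  have cA: "card (neighbors Z E ?A) \<le> Suc (card ?B)" and cB: "card (neighbors Z E ?B) \<le> Suc (card ?A)"
    using card_mono[OF _ NA] card_mono[OF _ NB] fin by auto
  have "{c, c} \<notin> E" using edge_card by fastforce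
  then have "independent Z E {c}" using c unfolding independent_def by blast
  then have "card {c} < card (neighbors Z E {c})" using expand by blast
  moreover have "neighbors Z E {c} \<subseteq> ?A \<union> ?B"
    using \<open>{c, c} \<notin> E\<close> unfolding neighbors_def by blast
  ultimately have "?A \<union> ?B \<noteq> {}" by (metis card.empty not_less_zero subset_empty)
  moreover have "?B = {}" if "?A = {}"
  proof (rule ccontr)
    assume "?B \<noteq> {}"
    then have "card ?B < Suc 0" using expand[OF B] cB that by simp
    then show False using \<open>?B \<noteq> {}\<close> fin by simp
  qed
  moreover have "?A = {}" if "?B = {}"
  proof (rule ccontr)
    assume "?A \<noteq> {}"
    then have "card ?A < Suc 0" using expand[OF A] cA that by simp
    then show False using \<open>?A \<noteq> {}\<close> fin by simp
  qed
  ultimately have "?A \<noteq> {}" "?B \<noteq> {}" by blast+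
  then have "card ?A = card ?B"
    using cA cB expand[OF A] expand[OF B] by linarith
  moreover have "Z = insert c (?A \<union> ?B)" using c by blast
  moreover have "card (insert c (?A \<union> ?B)) = Suc (card ?A + card ?B)"
    using fin by (subst card_insert_disjoint, simp, simp, subst card_Un_disjoint) auto
  ultimately have "card Z = Suc (2 * card ?A)" by simp
  moreover have "\<exists>S. independent Z E S \<and> card S = card ?A \<and> z \<notin> S" for z
    using A B \<open>card ?A = card ?B\<close> by (cases "z \<in> X") auto
  ultimately have "odd_critical_split V E I T Z m (card ?A)"
    by unfold_locales auto
  then show ?thesis by blast
qed

end

lemma odd_cycle_mono: "odd_cycle E C \<Longrightarrow> E \<subseteq> F \<Longrightarrow> odd_cycle F C"
  unfolding odd_cycle_def by blast

text \<open>Any vertex \<open>c\<close> of the unique odd cycle will do: an odd cycle in \<open>Z - {c}\<close> would be a second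
  one.\<close>

lemma almost_bipartite_imp_odd_critical_split:
  assumes G: "simple_graph V E" and "almost_bipartite E" and "\<not> konig_egervary V E"
  shows "\<exists>I T Z m k. odd_critical_split V E I T Z m k"
proof -
  obtain I T Z m where split: "critical_split V E I T Z m" using critical_split_exists[OF G] by blast
  interpret critical_split V E I T Z m by (rule split)
  have "Z \<noteq> {}" using konig_egervary_if_Z_empty assms(3) by blast
  then obtain C where C: "odd_cycle {e \<in> E. e \<subseteq> Z} C" using no_odd_cycle_in_Z_imp_Z_empty by blast
  then obtain xs where xs: "3 \<le> length xs" "C = cycle_edges xs" and CZ: "C \<subseteq> {e \<in> E. e \<subseteq> Z}"
    unfolding odd_cycle_def by blast
  let ?c = "xs ! 0" and ?e = "{xs ! 0, xs ! (Suc 0 mod length xs)}"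
  have e: "?e \<in> C" unfolding xs(2) cycle_edges_def using xs(1) by force
  then have c: "?c \<in> Z" using CZ by blast
  have "\<not> odd_cycle {e \<in> E. e \<subseteq> Z - {?c}} D" for D
  proof
    assume D: "odd_cycle {e \<in> E. e \<subseteq> Z - {?c}} D"
    have "odd_cycle E C" using odd_cycle_mono[OF C] by blast
    moreover have "odd_cycle E D" using odd_cycle_mono[OF D] by blast
    ultimately have "D = C" using assms(2) unfolding almost_bipartite_def by blast
    then show False using e D unfolding odd_cycle_def by blast
  qed
  then show ?thesis using odd_critical_split_if_bipartite_minus_vertex[OF c] by blast
qed

theorem theorem3p6:
  fixes V :: "'a set" and E :: "'a set set"
  assumes "simple_graph V E"
    and "almost_bipartite E"
    and "\<not> konig_egervary V E"
  shows "int (rho_v V E) =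
           int (card V) + critical_difference V E - int (xi V E) - int (beta V E) \<and>
         int (card V) + critical_difference V E - int (xi V E) - int (beta V E) =
           2 * int (independence_number V E) + 1 - int (xi V E) - int (beta V E)"
proof -
  obtain I T Z m k where split: "odd_critical_split V E I T Z m k"
    using almost_bipartite_imp_odd_critical_split[OF assms] by blast
  interpret odd_critical_split V E I T Z m k by (rule split)
  have "int (card V) + critical_difference V E = 2 * int (independence_number V E) + 1"
    unfolding card_V card_Z critical_difference_eq independence_number_eq by simp
  then show ?thesis using rho_v_eq unfolding independence_number_eq by linarith
qed

end
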